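(* Let $\mu$ be a Borel measure on $X=[0,\infty)$ (with the Euclidean metric) which is finite on bounded sets and has nonempty support, and let $c_0\ge 0$ be a constant. Then the following are equivalent: (i) $\lim_{\lambda\to 0^+}\lambda\,\mu(\{x\ge 0: M_\mu\nu(x)>\lambda\})=c_0\,\nu(X)$ for every finite Radon measure $\nu$ on $X$; (ii) $\lim_{\lambda\to 0^+}\lambda\,\mu(\{x\ge 0: M_\mu\delta_y(x)>\lambda\})=c_0$ for every $y\in[0,\infty)$.
   Context: Measures are nonnegative. For a metric space $(X,\rho)$ with Borel measure $\mu$, write $B(x,r)=\{y\in X:\rho(x,y)\le r\}$ (closed balls). The centered maximal operator of a finite Borel measure $\nu$ on $X$ is $$M_\mu\nu(x)=\sup_{r>r_0(x)}\frac{\nu(B(x,r))}{\mu(B(x,r))},\qquad r_0(x)=\inf\{r>0:\mu(B(x,r))>0\}.$$ Here $\rho(x,y)=|x-y|$. $\delta_y$ denotes the Dirac measure at the point $y$. *)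

theory Defs
  imports "HOL-Probability.Giry_Monad"
begin

text \<open>A metric space \<open>X\<close> is represented as a subset of a metric-space type, with the restricted
  distance; measures on \<open>X\<close> are measures whose space is \<open>X\<close>.\<close>

definition borel_on :: "'a::topological_space set \<Rightarrow> 'a measure" where
  "borel_on X = restrict_space borel X"

definition is_borel_measure_on :: "'a::topological_space set \<Rightarrow> 'a measure \<Rightarrow> bool" where
  "is_borel_measure_on X M \<longleftrightarrow> sets M = sets (borel_on X)"

definition finite_on_bounded :: "'a::metric_space measure \<Rightarrow> bool" where
  "finite_on_bounded M \<longleftrightarrow> (\<forall>A\<in>sets M. bounded A \<longrightarrow> emeasure M A < \<infinity>)"

definition msupport :: "'a::topological_space measure \<Rightarrow> 'a set" where
  "msupport M = {x \<in> space M. \<forall>U. open U \<and> x \<in> U \<longrightarrow> emeasure M (U \<inter> space M) > 0}"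

text \<open>Compact subsets of \<open>X\<close> are the same in \<open>X\<close> and in the ambient type.\<close>

definition is_radon_measure_on :: "'a::metric_space set \<Rightarrow> 'a measure \<Rightarrow> bool" where
  "is_radon_measure_on X M \<longleftrightarrow>
     is_borel_measure_on X M \<and>
     (\<forall>K. compact K \<and> K \<subseteq> X \<longrightarrow> emeasure M K < \<infinity>) \<and>
     (\<forall>A\<in>sets M. emeasure M A = (SUP K\<in>{K. compact K \<and> K \<subseteq> A}. emeasure M K))"

definition ball_in :: "'a::metric_space measure \<Rightarrow> 'a \<Rightarrow> real \<Rightarrow> 'a set" where
  "ball_in M x r = {y \<in> space M. dist x y \<le> r}"

text \<open>The infimum is over a nonempty set bounded below by \<open>0\<close> whenever \<open>\<mu>\<close> has nonempty support,
  so the real-valued \<open>Inf\<close> is the intended one.\<close>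

definition r0 :: "'a::metric_space measure \<Rightarrow> 'a \<Rightarrow> real" where
  "r0 \<mu> x = Inf {r. r > 0 \<and> emeasure \<mu> (ball_in \<mu> x r) > 0}"

definition centered_maximal :: "'a::metric_space measure \<Rightarrow> 'a measure \<Rightarrow> 'a \<Rightarrow> ennreal" where
  "centered_maximal \<mu> \<nu> x =
     (SUP r\<in>{r0 \<mu> x<..}. emeasure \<nu> (ball_in \<mu> x r) / emeasure \<mu> (ball_in \<mu> x r))"

definition dirac_on :: "'a::topological_space set \<Rightarrow> 'a \<Rightarrow> 'a measure" where
  "dirac_on X y = return (borel_on X) y"

end

(* A ball around a point x > A that carries mass of nu restricted to [0,A] contains A, and one that
   contains 0 contains [0,A]. With N = nu(X) and m = nu([0,A]), this gives up to the bounded set [0,A]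
     {M delta_0 > l/m}  <=  {M nu > l}  <=  {M delta_A > (1-t) l/N}  Un  {M (nu on (A,oo)) > t l}.
   The last set has mu-measure at most 2 nu((A,oo)) / (t l) by the weak type (1,1) bound for M, valid
   for every mu because finitely many intervals have a subcover of multiplicity at most two. Multiply
   by l, let l -> 0, then A -> oo and t -> 0. *)

theory Submission
  imports Defs
begin

text \<open>For centers in [0,A] the balls of \<nu> and of a Dirac measure cannot be compared, but
  [0,A] has finite \<mu>-measure, so l times it vanishes as l -> 0. Beyond A, a ball containing 0
  has radius at least its center and so swallows [0,A], of \<nu>-mass m; this gives the lower bound
  c * m. For the upper bound the mass of a ball is cut at A, and one of the two pieces exceeds its
  share, 1 - t or t, of the threshold. Since l times the measure of a superlevel set at height k * l
  tends to c / k, the near piece contributes c * N / (1 - t). The far piece is divided by t, so t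
  has to be fixed before A.

  The weak type bound cannot rest on enlarging balls by a fixed factor, because \<mu> need not be
  doubling; the order of the line replaces this.

  The recurring technical device is right continuity of r -> \<mu>(B(x,r)): a strict inequality
  survives a slightly larger radius. It gets past the excluded radius \<open>r0 \<mu> x\<close>,
  reaches rational radii, and replaces closed balls by open intervals.\<close>

section \<open>Finite covers by intervals\<close>

text \<open>The point \<open>p\<close> cuts every interval into a left and a right part. The
  interval reaching furthest left covers all left parts, the one reaching furthest right all right
  parts; the two may coincide.\<close>

lemma Union_intervals_through_point:
  fixes H :: "real set set"
  assumes "finite H" "H \<noteq> {}"
    and iv: "\<And>K. K \<in> H \<Longrightarrow> \<exists>a b. K = {a<..<b}" and p: "\<And>K. K \<in> H \<Longrightarrow> p \<in> K"
  obtains I J where "I \<in> H" "J \<in> H" "\<Union>H = I \<union> J"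
proof -
  have ends: "K = {Inf K<..<Sup K}" if K: "K \<in> H" for K
  proof -
    obtain a b where ab: "K = {a<..<b}" using iv[OF K] by blast
    moreover have "a < b" using p[OF K] ab by auto
    ultimately show ?thesis by simp
  qed
  have "Min (Inf ` H) \<in> Inf ` H" "Max (Sup ` H) \<in> Sup ` H"
    using assms(1,2) by auto
  then obtain I J where IJ: "I \<in> H" "Inf I = Min (Inf ` H)" "J \<in> H" "Sup J = Max (Sup ` H)"
    by (metis (no_types, lifting) imageE)
  have "K \<subseteq> I \<union> J" if K: "K \<in> H" for K
  proof
    fix z assume "z \<in> K"
    then have "z \<in> {Inf K<..<Sup K}" using ends[OF K] by blast
    then have z: "Inf K < z" "z < Sup K" by auto
    have "Inf I \<le> Inf K" "Sup K \<le> Sup J" using IJ assms(1) K by auto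
    moreover have "p \<in> {Inf I<..<Sup I}" "p \<in> {Inf J<..<Sup J}"
      using p[OF IJ(1)] p[OF IJ(3)] ends[OF IJ(1)] ends[OF IJ(3)] by blast+
    ultimately have "z \<in> {Inf I<..<Sup I} \<or> z \<in> {Inf J<..<Sup J}" using z by force
    then show "z \<in> I \<union> J" using ends[OF IJ(1)] ends[OF IJ(3)] by blast
  qed
  then have "\<Union>H = I \<union> J" using IJ(1,3) by auto
  with IJ(1,3) show thesis using that by blast
qed

text \<open>A subcover of least cardinality works: if three or more of its members shared a point,
  two of them would have the same union as all members through that point, and dropping the others
  would give a smaller subcover.\<close>

lemma finite_intervals_subcover_overlap_le_2:
  fixes F :: "real set set"
  assumes "finite F" and iv: "\<And>K. K \<in> F \<Longrightarrow> \<exists>a b. K = {a<..<b}"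
  obtains G where "G \<subseteq> F" "\<Union>G = \<Union>F" "\<And>p. card {K \<in> G. p \<in> K} \<le> 2"
proof -
  obtain G where G: "G \<subseteq> F" "\<Union>G = \<Union>F"
    and least: "\<And>G'. G' \<subseteq> F \<Longrightarrow> \<Union>G' = \<Union>F \<Longrightarrow> card G \<le> card G'"
  proof -
    have "\<exists>G. (G \<subseteq> F \<and> \<Union>G = \<Union>F) \<and> (\<forall>G'. G' \<subseteq> F \<and> \<Union>G' = \<Union>F \<longrightarrow> card G \<le> card G')"
      by (rule ex_has_least_nat[of _ F]) simp
    then show thesis using that by auto
  qed
  have finG: "finite G" using G(1) assms(1) finite_subset by blast
  have "card {K \<in> G. p \<in> K} \<le> 2" for p
  proof (rule ccontr)
    define H where "H = {K \<in> G. p \<in> K}"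
    assume "\<not> card {K \<in> G. p \<in> K} \<le> 2"
    then have H3: "card H > 2" unfolding H_def by simp
    have "finite H" using finG H_def by simp
    moreover have "H \<noteq> {}" using H3 by auto
    moreover have "\<exists>a b. K = {a<..<b}" "p \<in> K" if "K \<in> H" for K
      using that iv G(1) H_def by auto
    ultimately obtain I J where IJ: "I \<in> H" "J \<in> H" "\<Union>H = I \<union> J"
      by (rule Union_intervals_through_point)
    have HG: "H \<subseteq> G" using H_def by auto
    have "\<Union>((G - H) \<union> {I, J}) = \<Union>G" using IJ HG by blast
    then have "card G \<le> card ((G - H) \<union> {I, J})"
      using G IJ(1,2) HG by (intro least) auto
    also have "\<dots> \<le> card (G - H) + card {I, J}" by (rule card_Un_le)
    also have "\<dots> \<le> (card G - card H) + 2"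
      using card_Diff_subset[OF \<open>finite H\<close> HG] by (simp add: card_insert_if)
    finally show False using H3 card_mono[OF finG HG] by linarith
  qed
  then show thesis using that G by blast
qed

section \<open>Change of level and Dirac measures\<close>

lemma filterlim_times_at_right_0:
  fixes k :: real
  assumes "k > 0"
  shows "filterlim (\<lambda>l. k * l) (at_right 0) (at_right 0)"
  unfolding filterlim_at
proof
  show "((\<lambda>l. k * l) \<longlongrightarrow> 0) (at_right 0)"
    by (rule tendsto_eq_intros refl | simp)+
  show "\<forall>\<^sub>F l in at_right 0. k * l \<in> {0<..} \<and> k * l \<noteq> 0"
    using assms by (auto simp: eventually_at_filter)
qed

text \<open>Makes (ii) a special case of (i). Inner regularity is immediate because the compact set
  \<open>{y}\<close> already carries all the mass.\<close>

lemma is_radon_measure_on_dirac: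
  fixes X :: "'a::metric_space set"
  assumes "X \<in> sets borel" "y \<in> X"
  shows "is_radon_measure_on X (dirac_on X y)"
  unfolding is_radon_measure_on_def
proof (intro conjI allI ballI impI)
  let ?D = "dirac_on X y"
  have sets_D: "sets ?D = sets (borel_on X)" by (simp add: dirac_on_def)
  then show "is_borel_measure_on X ?D" by (simp add: is_borel_measure_on_def)
  have meas: "A \<in> sets ?D \<longleftrightarrow> A \<in> sets borel \<and> A \<subseteq> X" for A
    using assms(1) by (auto simp: sets_D borel_on_def sets_restrict_space_iff)
  have em: "emeasure ?D A = indicator A y" if "A \<in> sets ?D" for A
    using that by (simp add: dirac_on_def)
  show "emeasure ?D K < \<infinity>" if "compact K \<and> K \<subseteq> X" for K
  proof -
    have "K \<in> sets ?D" using that by (simp add: meas borel_compact)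
    then show ?thesis using em[of K] by (simp split: split_indicator)
  qed
  show "emeasure ?D A = (SUP K\<in>{K. compact K \<and> K \<subseteq> A}. emeasure ?D K)"
    if A: "A \<in> sets ?D" for A
  proof (rule antisym)
    show "(SUP K\<in>{K. compact K \<and> K \<subseteq> A}. emeasure ?D K) \<le> emeasure ?D A"
      using A by (auto intro!: SUP_least emeasure_mono)
    show "emeasure ?D A \<le> (SUP K\<in>{K. compact K \<and> K \<subseteq> A}. emeasure ?D K)"
    proof (cases "y \<in> A")
      case True
      moreover have "{y} \<in> sets ?D" using assms by (simp add: meas)
      ultimately have "emeasure ?D A = emeasure ?D {y}" using A em by simp
      then show ?thesis using True by (auto intro: SUP_upper)
    qed (simp add: em[OF A])
  qed
qed

lemma finite_measure_dirac_on: "y \<in> X \<Longrightarrow> finite_measure (dirac_on X y)"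
  unfolding dirac_on_def
  by (intro prob_space.finite_measure prob_space_return) (simp add: borel_on_def space_restrict_space)

section \<open>Superlevel sets of the maximal function\<close>

text \<open>The set where the maximal function exceeds \<open>l\<close>, freed of supremum, quotient
  and \<open>r0\<close>. Positivity of the \<mu>-mass excludes balls whose quotient would have
  denominator 0.\<close>

definition superlevel :: "real measure \<Rightarrow> real measure \<Rightarrow> real \<Rightarrow> real set" where
  "superlevel \<mu> \<nu> l = {x \<in> space \<mu>. \<exists>r>0. 0 < emeasure \<mu> (ball_in \<mu> x r) \<and>
     ennreal l * emeasure \<mu> (ball_in \<mu> x r) < emeasure \<nu> (ball_in \<mu> x r)}"

lemma superlevelI:
  assumes "x \<in> space \<mu>" "0 < r" "0 < emeasure \<mu> (ball_in \<mu> x r)"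
    "ennreal l * emeasure \<mu> (ball_in \<mu> x r) < emeasure \<nu> (ball_in \<mu> x r)"
  shows "x \<in> superlevel \<mu> \<nu> l"
  unfolding superlevel_def using assms by blast

lemma superlevelE:
  assumes "x \<in> superlevel \<mu> \<nu> l"
  obtains r where "x \<in> space \<mu>" "0 < r" "0 < emeasure \<mu> (ball_in \<mu> x r)"
    "ennreal l * emeasure \<mu> (ball_in \<mu> x r) < emeasure \<nu> (ball_in \<mu> x r)"
  using assms unfolding superlevel_def by blast

section \<open>Balls on the half-line\<close>

locale half_line_measure =
  fixes \<mu> :: "real measure"
  assumes sets_eq: "sets \<mu> = sets (borel_on {0..})"
    and finite_bounded: "finite_on_bounded \<mu>"
begin

lemma space_eq [simp]: "space \<mu> = {0..}"
  using sets_eq_imp_space_eq[OF sets_eq] by (simp add: borel_on_def space_restrict_space)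

lemma sets_iff: "A \<in> sets \<mu> \<longleftrightarrow> A \<in> sets borel \<and> A \<subseteq> {0..}"
  by (auto simp: sets_eq borel_on_def sets_restrict_space_iff)

lemma ball_in_eq: "ball_in \<mu> x r = cball x r \<inter> {0..}"
  by (auto simp: ball_in_def)

lemma ball_in_sets [simp, measurable]: "ball_in \<mu> x r \<in> sets \<mu>"
  by (simp add: ball_in_eq sets_iff)

lemma ball_in_mono: "r \<le> s \<Longrightarrow> ball_in \<mu> x r \<subseteq> ball_in \<mu> x s"
  by (auto simp: ball_in_eq)

lemma emeasure_ball_in_less_top [simp]: "emeasure \<mu> (ball_in \<mu> x r) < top"
proof -
  have "bounded (ball_in \<mu> x r)" unfolding ball_in_eq by (rule bounded_Int) simp
  then show ?thesis using finite_bounded ball_in_sets[of x r] unfolding finite_on_bounded_def by simp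
qed

lemma emeasure_Icc_less_top: "emeasure \<mu> {0..a} < top"
proof -
  have "ball_in \<mu> 0 a = {0..a}" by (auto simp: ball_in_eq)
  then show ?thesis using emeasure_ball_in_less_top[of 0 a] by simp
qed

text \<open>Needed for measuring sections of a product set, hence for measurability of the mass of a
  ball in its center.\<close>

lemma sigma_finite: "sigma_finite_measure \<mu>"
proof
  show "\<exists>A. countable A \<and> A \<subseteq> sets \<mu> \<and> \<Union> A = space \<mu> \<and> (\<forall>a\<in>A. emeasure \<mu> a \<noteq> \<infinity>)"
  proof (intro exI conjI)
    show "\<Union> (range (\<lambda>n::nat. {0..real n})) = space \<mu>"
      by (auto intro: real_arch_simple)
    show "\<forall>a\<in>range (\<lambda>n::nat. {0..real n}). emeasure \<mu> a \<noteq> \<infinity>"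
      using emeasure_Icc_less_top by (metis imageE infinity_ennreal_def less_irrefl)
  qed (auto simp: sets_iff)
qed

text \<open>Closed balls of radius \<open>r + 1 / (n + 1)\<close> decrease to the closed ball of
  radius \<open>r\<close> and have finite mass, so continuity from above applies.\<close>

lemma emeasure_ball_in_right_continuous:
  assumes "0 < c" "ennreal l * emeasure \<mu> (ball_in \<mu> x r) < c"
  obtains d where "0 < d" "ennreal l * emeasure \<mu> (ball_in \<mu> x (r + d)) < c"
proof -
  let ?B = "\<lambda>n. ball_in \<mu> x (r + inverse (real (Suc n)))"
  have "decseq ?B"
    by (intro decseq_SucI ball_in_mono) (simp add: field_simps)
  have inter: "(\<Inter>n. ?B n) = ball_in \<mu> x r"
  proof (intro equalityI INT_greatest ball_in_mono subsetI)
    fix y assume y: "y \<in> (\<Inter>n. ?B n)"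
    then have "0 \<le> y" by (auto simp: ball_in_eq)
    moreover have "dist x y \<le> r"
    proof (rule LIMSEQ_le_const)
      show "(\<lambda>n. r + inverse (real (Suc n))) \<longlonglongrightarrow> r"
        using tendsto_add[OF tendsto_const LIMSEQ_inverse_real_of_nat, of r] by simp
    qed (use y in \<open>auto simp: ball_in_eq\<close>)
    ultimately show "y \<in> ball_in \<mu> x r" by (simp add: ball_in_eq)
  qed simp
  have "(\<lambda>n. emeasure \<mu> (?B n)) \<longlonglongrightarrow> emeasure \<mu> (\<Inter>n. ?B n)"
    using \<open>decseq ?B\<close> emeasure_ball_in_less_top
    by (intro Lim_emeasure_decseq) (auto simp: less_top)
  then have "(\<lambda>n. ennreal l * emeasure \<mu> (?B n)) \<longlonglongrightarrow> ennreal l * emeasure \<mu> (ball_in \<mu> x r)"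
    unfolding inter by (intro ennreal_tendsto_cmult) auto
  from order_tendstoD(2)[OF this assms(2)] obtain n where
    "ennreal l * emeasure \<mu> (?B n) < c" by (auto simp: eventually_sequentially)
  then show thesis using that[of "inverse (real (Suc n))"] by simp
qed

text \<open>The last conclusion is the strongest: it weighs the larger ball by \<mu> but the
  original one by \<nu>, so anything squeezed between the two inherits the inequality.\<close>

lemma superlevel_witness_enlarge:
  assumes "sets \<nu> = sets \<mu>" "ennreal l * emeasure \<mu> (ball_in \<mu> x r) < emeasure \<nu> (ball_in \<mu> x r)"
  obtains d where "0 < d" "\<And>s. r \<le> s \<Longrightarrow> s \<le> r + d \<Longrightarrow>
     ennreal l * emeasure \<mu> (ball_in \<mu> x s) < emeasure \<nu> (ball_in \<mu> x s)"
     "ennreal l * emeasure \<mu> (ball_in \<mu> x (r + d)) < emeasure \<nu> (ball_in \<mu> x r)"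
proof -
  have "0 < emeasure \<nu> (ball_in \<mu> x r)"
    using assms(2) by (metis not_gr_zero not_less_zero)
  then obtain d where d: "0 < d" "ennreal l * emeasure \<mu> (ball_in \<mu> x (r + d)) < emeasure \<nu> (ball_in \<mu> x r)"
    using emeasure_ball_in_right_continuous assms(2) by blast
  moreover have "ennreal l * emeasure \<mu> (ball_in \<mu> x s) < emeasure \<nu> (ball_in \<mu> x s)"
    if "r \<le> s" "s \<le> r + d" for s
  proof -
    have "ennreal l * emeasure \<mu> (ball_in \<mu> x s) \<le> ennreal l * emeasure \<mu> (ball_in \<mu> x (r + d))"
      using that by (intro mult_left_mono emeasure_mono ball_in_mono) auto
    also note d(2)
    also have "emeasure \<nu> (ball_in \<mu> x r) \<le> emeasure \<nu> (ball_in \<mu> x s)"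
      using that assms(1) by (intro emeasure_mono ball_in_mono) auto
    finally show ?thesis .
  qed
  ultimately show thesis using that by blast
qed

text \<open>Right continuity in \<open>r\<close> makes the condition \<open>r > r0 \<mu> x\<close> interchangeable with positivity of
  the measure of the ball.\<close>

lemma centered_maximal_superlevel:
  assumes "msupport \<mu> \<noteq> {}" "sets \<nu> = sets \<mu>" "l > 0"
  shows "{x \<in> {0..}. centered_maximal \<mu> \<nu> x > ennreal l} = superlevel \<mu> \<nu> l"
proof -
  have iff: "centered_maximal \<mu> \<nu> x > ennreal l \<longleftrightarrow> (\<exists>r>0. 0 < emeasure \<mu> (ball_in \<mu> x r) \<and>
      ennreal l * emeasure \<mu> (ball_in \<mu> x r) < emeasure \<nu> (ball_in \<mu> x r))" for x
  proof -
    let ?S = "{r. r > 0 \<and> emeasure \<mu> (ball_in \<mu> x r) > 0}"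
    have bdd: "bdd_below ?S" by (rule bdd_belowI[of _ 0]) auto
    have ne: "?S \<noteq> {}"
    proof -
      obtain z where z: "z \<in> space \<mu>" "\<And>U. open U \<Longrightarrow> z \<in> U \<Longrightarrow> emeasure \<mu> (U \<inter> space \<mu>) > 0"
        using assms(1) unfolding msupport_def by blast
      have "0 < emeasure \<mu> (ball z 1 \<inter> space \<mu>)" using z by simp
      also have "\<dots> \<le> emeasure \<mu> (ball_in \<mu> x (dist x z + 1))"
      proof (rule emeasure_mono)
        show "ball z 1 \<inter> space \<mu> \<subseteq> ball_in \<mu> x (dist x z + 1)"
          by (auto simp: ball_in_eq dist_real_def)
      qed simp
      finally have "dist x z + 1 \<in> ?S" by (simp add: add_nonneg_pos)
      then show ?thesis by blast
    qed
    have pos: "0 < r \<and> 0 < emeasure \<mu> (ball_in \<mu> x r)" if r: "r0 \<mu> x < r" for r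
    proof -
      obtain s where s: "s \<in> ?S" "s < r"
        using cInf_lessD[OF ne, of r] r unfolding r0_def by blast
      then have "emeasure \<mu> (ball_in \<mu> x s) \<le> emeasure \<mu> (ball_in \<mu> x r)"
        by (intro emeasure_mono ball_in_mono) auto
      with s show ?thesis by auto
    qed
    have le: "r0 \<mu> x \<le> r" if "0 < r" "0 < emeasure \<mu> (ball_in \<mu> x r)" for r
      unfolding r0_def using that bdd by (intro cInf_lower) auto
    have div: "ennreal l < b / a \<longleftrightarrow> ennreal l * a < b" if "0 < a" "a < top" for a b :: ennreal
      using that assms(3)
      by (cases a; cases b)
        (auto simp: divide_ennreal ennreal_mult[symmetric] ennreal_less_iff field_simps
          ennreal_top_divide ennreal_mult_less_top less_top)
    have "centered_maximal \<mu> \<nu> x > ennreal l \<longleftrightarrow>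
        (\<exists>r>r0 \<mu> x. ennreal l * emeasure \<mu> (ball_in \<mu> x r) < emeasure \<nu> (ball_in \<mu> x r))"
      unfolding centered_maximal_def less_SUP_iff using pos div by (auto simp: Bex_def)
    also have "\<dots> \<longleftrightarrow> (\<exists>r>0. 0 < emeasure \<mu> (ball_in \<mu> x r) \<and>
      ennreal l * emeasure \<mu> (ball_in \<mu> x r) < emeasure \<nu> (ball_in \<mu> x r))"
    proof safe
      \<comment> \<open>Here \<open>r\<close> may equal \<open>r0 \<mu> x\<close>, a radius outside
        the supremum; \<open>r + d\<close> lies beyond it and keeps the inequality.\<close>
      fix r assume r: "0 < r" "0 < emeasure \<mu> (ball_in \<mu> x r)"
        "ennreal l * emeasure \<mu> (ball_in \<mu> x r) < emeasure \<nu> (ball_in \<mu> x r)"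
      obtain d where "0 < d" "ennreal l * emeasure \<mu> (ball_in \<mu> x (r + d)) < emeasure \<nu> (ball_in \<mu> x (r + d))"
        using superlevel_witness_enlarge[OF assms(2) r(3)] by (metis less_eq_real_def less_add_same_cancel1)
      then show "\<exists>r>r0 \<mu> x. ennreal l * emeasure \<mu> (ball_in \<mu> x r) < emeasure \<nu> (ball_in \<mu> x r)"
        using le[OF r(1,2)] by (intro exI[of _ "r + d"]) auto
    qed (use pos in blast)
    finally show ?thesis .
  qed
  show ?thesis by (simp add: superlevel_def iff)
qed

section \<open>Measurability\<close>

text \<open>The ball is the section at \<open>x\<close> of the measurable set of pairs at distance
  at most \<open>r\<close>, and the measure of a section depends measurably on the point.\<close>

lemma emeasure_ball_in_measurable:
  assumes "sigma_finite_measure \<nu>" "sets \<nu> = sets \<mu>"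
  shows "(\<lambda>x. emeasure \<nu> (ball_in \<mu> x r)) \<in> borel_measurable borel"
proof -
  interpret sigma_finite_measure \<nu> by fact
  have "space \<nu> = {0..}" using sets_eq_imp_space_eq[OF assms(2)] by simp
  have "(\<lambda>y. y) \<in> measurable \<nu> borel"
    using assms(2) unfolding sets_eq borel_on_def
    by (subst measurable_cong_sets[OF _ refl, of _ "restrict_space borel {0..}"])
      (auto intro: measurable_restrict_space1)
  then have [measurable]: "snd \<in> borel_measurable (borel \<Otimes>\<^sub>M \<nu>)"
    using measurable_compose[OF measurable_snd] by fastforce
  have [measurable]: "fst \<in> borel_measurable (borel \<Otimes>\<^sub>M \<nu> :: (real \<times> real) measure)"
    by simp
  have "{z \<in> space (borel \<Otimes>\<^sub>M \<nu>). dist (fst z) (snd z) \<le> r} \<in> sets (borel \<Otimes>\<^sub>M \<nu>)"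
    by measurable
  then have "(\<lambda>x. emeasure \<nu> (Pair x -` {z \<in> space (borel \<Otimes>\<^sub>M \<nu>). dist (fst z) (snd z) \<le> r}))
      \<in> borel_measurable borel"
    by (rule measurable_emeasure_Pair)
  moreover have "Pair x -` {z \<in> space (borel \<Otimes>\<^sub>M \<nu>). dist (fst z) (snd z) \<le> r} = ball_in \<mu> x r" for x
    using \<open>space \<nu> = {0..}\<close> by (auto simp: space_pair_measure ball_in_eq)
  ultimately show ?thesis by simp
qed

text \<open>Subadditivity of \<open>emeasure\<close> requires measurable sets. The uncountable union
  over radii reduces to a countable one, since every witness radius can be enlarged to a rational
  one.\<close>

lemma superlevel_sets:
  assumes "finite_measure \<nu>" "sets \<nu> = sets \<mu>"
  shows "superlevel \<mu> \<nu> l \<in> sets \<mu>"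
proof -
  have [measurable]: "(\<lambda>x. emeasure \<mu> (ball_in \<mu> x r)) \<in> borel_measurable borel"
    "(\<lambda>x. emeasure \<nu> (ball_in \<mu> x r)) \<in> borel_measurable borel" for r
    using emeasure_ball_in_measurable sigma_finite assms finite_measure.axioms(1) by auto
  have "superlevel \<mu> \<nu> l = (\<Union>q\<in>{q. 0 < real_of_rat q}. {x. 0 < emeasure \<mu> (ball_in \<mu> x (real_of_rat q)) \<and>
      ennreal l * emeasure \<mu> (ball_in \<mu> x (real_of_rat q)) < emeasure \<nu> (ball_in \<mu> x (real_of_rat q))}) \<inter> {0..}"
    (is "_ = ?R")
  proof
    show "superlevel \<mu> \<nu> l \<subseteq> ?R"
    proof
      fix x assume "x \<in> superlevel \<mu> \<nu> l"
      then obtain r where r: "0 \<le> x" "0 < r" "0 < emeasure \<mu> (ball_in \<mu> x r)"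
        "ennreal l * emeasure \<mu> (ball_in \<mu> x r) < emeasure \<nu> (ball_in \<mu> x r)"
        by (auto elim!: superlevelE)
      obtain d where d: "0 < d" "\<And>s. r \<le> s \<Longrightarrow> s \<le> r + d \<Longrightarrow>
          ennreal l * emeasure \<mu> (ball_in \<mu> x s) < emeasure \<nu> (ball_in \<mu> x s)"
        using superlevel_witness_enlarge[OF assms(2) r(4)] by metis
      obtain q where q: "r < real_of_rat q" "real_of_rat q < r + d"
        using of_rat_dense[of r "r + d"] d(1) by auto
      have "emeasure \<mu> (ball_in \<mu> x r) \<le> emeasure \<mu> (ball_in \<mu> x (real_of_rat q))"
        using q by (intro emeasure_mono ball_in_mono) auto
      then have "0 < emeasure \<mu> (ball_in \<mu> x (real_of_rat q))" "0 < real_of_rat q"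
        using r q by (blast intro: less_le_trans, linarith)
      moreover have "ennreal l * emeasure \<mu> (ball_in \<mu> x (real_of_rat q)) < emeasure \<nu> (ball_in \<mu> x (real_of_rat q))"
        using q by (intro d(2)) auto
      ultimately show "x \<in> ?R" using r(1) by blast
    qed
    show "?R \<subseteq> superlevel \<mu> \<nu> l"
    proof
      fix x assume "x \<in> ?R"
      then obtain q where "0 \<le> x" "0 < real_of_rat q" "0 < emeasure \<mu> (ball_in \<mu> x (real_of_rat q))"
        "ennreal l * emeasure \<mu> (ball_in \<mu> x (real_of_rat q)) < emeasure \<nu> (ball_in \<mu> x (real_of_rat q))"
        by blast
      then show "x \<in> superlevel \<mu> \<nu> l" by (intro superlevelI[of _ _ "real_of_rat q"]) simp_all
    qed
  qed
  moreover have "?R \<in> sets borel"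
  proof (intro sets.Int sets.countable_UN')
    show "countable {q. 0 < real_of_rat q}" by (rule countable_subset[OF subset_UNIV]) simp
    have "{x \<in> space borel. 0 < emeasure \<mu> (ball_in \<mu> x r) \<and>
        ennreal l * emeasure \<mu> (ball_in \<mu> x r) < emeasure \<nu> (ball_in \<mu> x r)} \<in> sets borel" for r
      by measurable
    then show "(\<lambda>q. {x. 0 < emeasure \<mu> (ball_in \<mu> x (real_of_rat q)) \<and>
        ennreal l * emeasure \<mu> (ball_in \<mu> x (real_of_rat q)) < emeasure \<nu> (ball_in \<mu> x (real_of_rat q))})
        ` {q. 0 < real_of_rat q} \<subseteq> sets borel" by auto
  qed simp
  ultimately show ?thesis by (simp add: sets_iff)
qed

section \<open>The weak type (1,1) inequality\<close>

text \<open>The factor 2 is the overlap bound: after thinning the cover, the indicators of its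
  members sum to at most 2 pointwise, and integrating against \<nu> bounds the sum of their
  masses.\<close>

lemma emeasure_Union_intervals_le:
  assumes fin: "finite F" and sets: "sets \<nu> = sets \<mu>"
    and iv: "\<And>K. K \<in> F \<Longrightarrow> \<exists>a b. K = {a<..<b}"
    and le: "\<And>K. K \<in> F \<Longrightarrow> ennreal l * emeasure \<mu> (K \<inter> {0..}) \<le> emeasure \<nu> (K \<inter> {0..})"
  shows "ennreal l * emeasure \<mu> (\<Union>F \<inter> {0..}) \<le> 2 * emeasure \<nu> {0..}"
proof -
  obtain G where G: "G \<subseteq> F" "\<Union>G = \<Union>F" "\<And>p. card {K \<in> G. p \<in> K} \<le> 2"
    using finite_intervals_subcover_overlap_le_2[OF fin iv] by blast
  have finG: "finite G" using G(1) fin finite_subset by blast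
  have meas: "K \<inter> {0..} \<in> sets \<mu>" if K: "K \<in> G" for K
  proof -
    obtain a b where "K = {a<..<b}" using iv[of K] K G(1) by blast
    then show ?thesis by (simp add: sets_iff)
  qed
  have "emeasure \<mu> (\<Union>F \<inter> {0..}) = emeasure \<mu> (\<Union>K\<in>G. K \<inter> {0..})"
    using G(2) by (intro arg_cong[of _ _ "emeasure \<mu>"]) auto
  also have "\<dots> \<le> (\<Sum>K\<in>G. emeasure \<mu> (K \<inter> {0..}))"
    using finG meas by (intro emeasure_subadditive_finite) auto
  finally have "ennreal l * emeasure \<mu> (\<Union>F \<inter> {0..}) \<le> ennreal l * (\<Sum>K\<in>G. emeasure \<mu> (K \<inter> {0..}))"
    by (rule mult_left_mono) simp
  also have "\<dots> \<le> (\<Sum>K\<in>G. emeasure \<nu> (K \<inter> {0..}))"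
    unfolding sum_distrib_left using le G(1) by (intro sum_mono) auto
  also have "\<dots> = (\<Sum>K\<in>G. \<integral>\<^sup>+ x. indicator (K \<inter> {0..}) x \<partial>\<nu>)"
    using meas sets by (intro sum.cong) auto
  also have "\<dots> = (\<integral>\<^sup>+ x. (\<Sum>K\<in>G. indicator (K \<inter> {0..}) x) \<partial>\<nu>)"
    using meas sets by (intro nn_integral_sum[symmetric]) auto
  also have "\<dots> \<le> (\<integral>\<^sup>+ x. 2 * indicator {0..} x \<partial>\<nu>)"
  proof (rule nn_integral_mono)
    fix x :: real
    have "(\<Sum>K\<in>G. indicator (K \<inter> {0..}) x :: ennreal) \<le> (\<Sum>K\<in>G. if x \<in> K then indicator {0..} x else 0)"
      by (intro sum_mono) (auto split: split_indicator)
    also have "\<dots> = of_nat (card {K \<in> G. x \<in> K}) * indicator {0..} x"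
      using finG by (simp add: sum.If_cases Int_def)
    also have "\<dots> \<le> of_nat 2 * indicator {0..} x"
      using G(3)[of x] by (intro mult_right_mono) (auto simp del: of_nat_numeral)
    finally show "(\<Sum>K\<in>G. indicator (K \<inter> {0..}) x) \<le> (2 * indicator {0..} x :: ennreal)" by simp
  qed
  also have "\<dots> = 2 * emeasure \<nu> {0..}"
    using sets by (subst nn_integral_cmult_indicator) (auto simp: sets_iff)
  finally show ?thesis .
qed

text \<open>Each witness ball is widened to an open interval that still satisfies the (weak)
  inequality. Openness yields a countable subcover, and the finite case passes to the limit along
  its increasing partial unions.\<close>

lemma weak_type_bound:
  assumes sets: "sets \<nu> = sets \<mu>"
  shows "ennreal l * emeasure \<mu> (superlevel \<mu> \<nu> l) \<le> 2 * emeasure \<nu> {0..}"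
proof -
  define F where "F = {K. (\<exists>a b. K = {a<..<b}) \<and>
    ennreal l * emeasure \<mu> (K \<inter> {0..}) \<le> emeasure \<nu> (K \<inter> {0..})}"
  have cover: "superlevel \<mu> \<nu> l \<subseteq> \<Union>F \<inter> {0..}"
  proof
    fix x assume "x \<in> superlevel \<mu> \<nu> l"
    then obtain r where r: "0 \<le> x" "0 < r"
      "ennreal l * emeasure \<mu> (ball_in \<mu> x r) < emeasure \<nu> (ball_in \<mu> x r)"
      by (auto elim!: superlevelE)
    obtain d where d: "0 < d"
      "ennreal l * emeasure \<mu> (ball_in \<mu> x (r + d)) < emeasure \<nu> (ball_in \<mu> x r)"
      using superlevel_witness_enlarge[OF sets r(3)] by metis
    \<comment> \<open>Within the half-line, \<open>K\<close> lies between the closed balls of radius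
      \<open>r\<close> and \<open>r + d\<close>: the larger bounds its \<mu>-mass above, the smaller
      its \<nu>-mass below.\<close>
    define K where "K = {x - (r + d)<..<x + (r + d)}"
    have Ks: "K \<inter> {0..} \<in> sets \<mu>" by (auto simp: K_def sets_iff)
    have "ennreal l * emeasure \<mu> (K \<inter> {0..}) \<le> ennreal l * emeasure \<mu> (ball_in \<mu> x (r + d))"
    proof (intro mult_left_mono emeasure_mono)
      show "K \<inter> {0..} \<subseteq> ball_in \<mu> x (r + d)" by (auto simp: K_def ball_in_eq dist_real_def)
    qed simp_all
    also note d(2)
    also have "emeasure \<nu> (ball_in \<mu> x r) \<le> emeasure \<nu> (K \<inter> {0..})"
      using Ks sets d(1) by (intro emeasure_mono) (auto simp: K_def ball_in_eq dist_real_def)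
    finally have "K \<in> F" unfolding F_def K_def by auto
    moreover have "x \<in> K" using r d by (simp add: K_def)
    ultimately show "x \<in> \<Union>F \<inter> {0..}" using r(1) by auto
  qed
  have "open S" if "S \<in> F" for S using that unfolding F_def by auto
  then obtain F' where F': "F' \<subseteq> F" "countable F'" "\<Union>F' = \<Union>F"
    using Lindelof by metis
  show ?thesis
  \<comment> \<open>\<open>from_nat_into\<close> enumerates only nonempty sets, so an empty cover is
    treated apart.\<close>
  proof (cases "F' = {}")
    case True
    show ?thesis
    proof -
      have "superlevel \<mu> \<nu> l = {}" using cover F'(3) True by blast
      then show ?thesis by simp
    qed
  next
    case False
    define V where "V n = \<Union>(from_nat_into F' ` {..n}) \<inter> {0..}" for n
    have sub: "from_nat_into F' ` {..n} \<subseteq> F" for n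
      using from_nat_into[OF False] F'(1) by auto
    have V: "V n \<in> sets \<mu>" for n
    proof -
      have "open (\<Union>(from_nat_into F' ` {..n}))"
        using \<open>\<And>S. S \<in> F \<Longrightarrow> open S\<close> sub[of n] by blast
      then show ?thesis unfolding V_def by (simp add: sets_iff)
    qed
    have "incseq V" unfolding V_def by (intro incseq_SucI) (auto simp: atMost_Suc)
    have UV: "(\<Union>n. V n) = \<Union>F \<inter> {0..}"
    proof -
      have "(\<Union>n. V n) = \<Union>(range (from_nat_into F')) \<inter> {0..}" unfolding V_def by auto
      then show ?thesis using range_from_nat_into[OF False F'(2)] F'(3) by simp
    qed
    have "ennreal l * emeasure \<mu> (superlevel \<mu> \<nu> l) \<le> ennreal l * emeasure \<mu> (\<Union>n. V n)"
      using cover V unfolding UV[symmetric] by (intro mult_left_mono emeasure_mono) auto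
    also have "\<dots> = ennreal l * (SUP n. emeasure \<mu> (V n))"
      using V \<open>incseq V\<close> by (subst SUP_emeasure_incseq) auto
    also have "\<dots> = (SUP n. ennreal l * emeasure \<mu> (V n))"
      by (rule SUP_mult_left_ennreal)
    also have "\<dots> \<le> 2 * emeasure \<nu> {0..}"
    proof (rule SUP_least)
      fix n
      show "ennreal l * emeasure \<mu> (V n) \<le> 2 * emeasure \<nu> {0..}"
        unfolding V_def using sub[of n] sets
        by (intro emeasure_Union_intervals_le) (auto simp: F_def image_subset_iff)
    qed
    finally show ?thesis .
  qed
qed

section \<open>Comparison with Dirac measures\<close>

text \<open>If the far piece of the ball has at most the share \<open>t\<close> of the threshold,
  the near piece has more than the share \<open>1 - t\<close>. The near piece has mass at most N, so
  dividing by N leaves the value 1 of the Dirac measure, provided the ball contains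
  \<open>A\<close>.\<close>

lemma superlevel_split:
  assumes fin: "finite_measure \<nu>" and sets: "sets \<nu> = sets \<mu>"
    and t: "0 < t" "t < 1" and A: "0 \<le> A" and l: "0 < l" and N: "0 < measure \<nu> {0..}"
  shows "superlevel \<mu> \<nu> l \<subseteq> {0..A} \<union>
     superlevel \<mu> (dirac_on {0..} A) ((1 - t) / measure \<nu> {0..} * l) \<union>
     superlevel \<mu> (density \<nu> (indicator {A<..})) (t * l)"
proof (intro subsetI, rule ccontr)
  fix x
  assume "x \<in> superlevel \<mu> \<nu> l" and notin: "x \<notin> {0..A} \<union>
     superlevel \<mu> (dirac_on {0..} A) ((1 - t) / measure \<nu> {0..} * l) \<union>
     superlevel \<mu> (density \<nu> (indicator {A<..})) (t * l)"
  then obtain r where r: "0 \<le> x" "0 < r" "0 < emeasure \<mu> (ball_in \<mu> x r)"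
    "ennreal l * emeasure \<mu> (ball_in \<mu> x r) < emeasure \<nu> (ball_in \<mu> x r)"
    by (auto elim!: superlevelE)
  interpret finite_measure \<nu> by fact
  let ?B = "ball_in \<mu> x r" and ?N = "measure \<nu> {0..}"
  obtain b where b: "0 \<le> b" "emeasure \<mu> ?B = ennreal b"
    using emeasure_ball_in_less_top[of x r] by (metis ennreal_enn2real enn2real_nonneg)
  have xA: "A < x" using notin r(1) by auto
  have meas: "?B \<inter> {0..A} \<in> sets \<nu>" "?B \<inter> {A<..} \<in> sets \<nu>" "{0..} \<in> sets \<nu>" "{A<..} \<in> sets \<nu>" "?B \<in> sets \<nu>"
    using A sets by (auto simp: sets_iff ball_in_eq)
  have "emeasure \<nu> ({A<..} \<inter> ?B) \<le> ennreal (t * l) * emeasure \<mu> ?B"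
    using notin superlevelI[of x \<mu> r "t * l" "density \<nu> (indicator {A<..})"] r meas(4,5)
    by (simp add: emeasure_restricted not_less[symmetric]) blast
  then have 1: "measure \<nu> (?B \<inter> {A<..}) \<le> t * l * b"
    using b t l by (simp add: Int_commute emeasure_eq_measure ennreal_mult'[symmetric])
  have "l * b < measure \<nu> ?B"
    using r(4) b l by (simp add: emeasure_eq_measure ennreal_mult'[symmetric] ennreal_less_iff)
  also have "measure \<nu> ?B = measure \<nu> (?B \<inter> {0..A}) + measure \<nu> (?B \<inter> {A<..})"
    using meas by (subst finite_measure_Union[symmetric]) (auto intro!: arg_cong[of _ _ "measure \<nu>"] simp: ball_in_eq)
  finally have 2: "(1 - t) * l * b < measure \<nu> (?B \<inter> {0..A})"
    using 1 by (simp add: algebra_simps)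
  moreover have "0 \<le> (1 - t) * l * b" using t l b by simp
  ultimately have "?B \<inter> {0..A} \<noteq> {}" by auto
  \<comment> \<open>The ball is convex and contains its center, right of \<open>A\<close>, and a
    point of [0,A].\<close>
  then have "A \<in> ?B" using xA A by (auto simp: ball_in_eq dist_real_def)
  then have D: "emeasure (dirac_on {0..} A) ?B = 1"
    using ball_in_sets[of x r] by (simp add: dirac_on_def sets_eq)
  have "measure \<nu> (?B \<inter> {0..A}) \<le> ?N" using meas by (intro finite_measure_mono) auto
  then have "(1 - t) / ?N * l * b < 1" using 2 N by (simp add: field_simps)
  then have "ennreal ((1 - t) / ?N * l) * emeasure \<mu> ?B < 1"
    using b t l N by (simp add: ennreal_mult'[symmetric] ennreal_less_one_iff)
  then have "x \<in> superlevel \<mu> (dirac_on {0..} A) ((1 - t) / ?N * l)"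
    using r D by (intro superlevelI[of _ _ r]) auto
  then show False using notin by auto
qed

text \<open>A witness ball for the Dirac measure contains 0, so its radius is at least
  \<open>x\<close> and it contains [0,2x]. If \<open>x > A\<close>, its \<nu>-mass is therefore at
  least that of [0,A], enough to exceed level \<open>l\<close>.\<close>

lemma superlevel_dirac_0_subset:
  assumes fin: "finite_measure \<nu>" and sets: "sets \<nu> = sets \<mu>"
    and A: "0 \<le> A" and l: "0 < l" and m: "0 < measure \<nu> {0..A}"
  shows "superlevel \<mu> (dirac_on {0..} 0) (1 / measure \<nu> {0..A} * l) \<subseteq> {0..A} \<union> superlevel \<mu> \<nu> l"
proof (intro subsetI UnCI)
  fix x
  interpret finite_measure \<nu> by fact
  let ?m = "measure \<nu> {0..A}"
  assume "x \<in> superlevel \<mu> (dirac_on {0..} 0) (1 / ?m * l)" and "x \<notin> superlevel \<mu> \<nu> l"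
  then obtain r where r: "0 \<le> x" "0 < r" "0 < emeasure \<mu> (ball_in \<mu> x r)"
    "ennreal (1 / ?m * l) * emeasure \<mu> (ball_in \<mu> x r) < emeasure (dirac_on {0..} 0) (ball_in \<mu> x r)"
    by (auto elim!: superlevelE)
  have notin: "emeasure \<nu> (ball_in \<mu> x r) \<le> ennreal l * emeasure \<mu> (ball_in \<mu> x r)"
    using \<open>x \<notin> superlevel \<mu> \<nu> l\<close> superlevelI[of x \<mu> r l \<nu>] r by (simp add: not_less[symmetric]) blast
  let ?B = "ball_in \<mu> x r"
  obtain b where b: "0 \<le> b" "emeasure \<mu> ?B = ennreal b"
    using emeasure_ball_in_less_top[of x r] by (metis ennreal_enn2real enn2real_nonneg)
  have D: "emeasure (dirac_on {0..} 0) ?B = indicator ?B 0"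
    using ball_in_sets[of x r] by (simp add: dirac_on_def sets_eq)
  then have "0 \<in> ?B" using r(4) by (auto split: split_indicator_asm)
  then have "x \<le> r" "indicator ?B 0 = (1::ennreal)" by (auto simp: ball_in_eq dist_real_def)
  with r(4) D b m l have lt: "l * b < ?m"
    by (simp add: ennreal_mult'[symmetric] ennreal_less_one_iff field_simps)
  show "x \<in> {0..A}"
  proof (rule ccontr)
    assume "x \<notin> {0..A}"
    then have "{0..A} \<subseteq> ?B" using r(1) \<open>x \<le> r\<close> by (auto simp: ball_in_eq dist_real_def)
    then have "?m \<le> measure \<nu> ?B" using sets by (intro finite_measure_mono) auto
    also have "\<dots> \<le> l * b"
      using notin b l by (simp add: emeasure_eq_measure ennreal_mult'[symmetric])
    finally show False using lt by simp
  qed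
qed

section \<open>Passage to the limit\<close>

lemma times_emeasure_Icc_tendsto_0:
  "((\<lambda>l. ennreal l * emeasure \<mu> {0..A}) \<longlongrightarrow> 0) (at_right 0)"
proof -
  obtain b where b: "0 \<le> b" "emeasure \<mu> {0..A} = ennreal b"
    using emeasure_Icc_less_top[of A] by (metis ennreal_enn2real enn2real_nonneg)
  have "((\<lambda>l. ennreal (l * b)) \<longlongrightarrow> ennreal (0 * b)) (at_right 0)"
    by (intro tendsto_intros)
  then show ?thesis using b by (simp add: ennreal_mult''[symmetric])
qed

text \<open>Substitute \<open>k * l\<close> for the level and compensate with the factor
  \<open>1 / k\<close>. Used with k = (1 - t) / N and with k = 1 / m, giving the limits c * N / (1 -
  t) and c * m.\<close>

lemma superlevel_rescale:
  assumes "0 < k"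
    and "((\<lambda>l. ennreal l * emeasure \<mu> (superlevel \<mu> \<nu> l)) \<longlongrightarrow> ennreal c) (at_right 0)"
  shows "((\<lambda>l. ennreal l * emeasure \<mu> (superlevel \<mu> \<nu> (k * l))) \<longlongrightarrow> ennreal (c / k)) (at_right 0)"
proof -
  have "((\<lambda>l. ennreal (1 / k) * (ennreal (k * l) * emeasure \<mu> (superlevel \<mu> \<nu> (k * l))))
      \<longlongrightarrow> ennreal (1 / k) * ennreal c) (at_right 0)"
    using filterlim_compose[OF assms(2) filterlim_times_at_right_0[OF assms(1)]]
    by (intro ennreal_tendsto_cmult) auto
  also have "(\<lambda>l. ennreal (1 / k) * (ennreal (k * l) * emeasure \<mu> (superlevel \<mu> \<nu> (k * l))))
      = (\<lambda>l. ennreal l * emeasure \<mu> (superlevel \<mu> \<nu> (k * l)))"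
    using assms(1) by (simp add: mult.assoc[symmetric] ennreal_mult'[symmetric])
  also have "ennreal (1 / k) * ennreal c = ennreal (c / k)"
    using assms(1) by (simp add: ennreal_mult'[symmetric])
  finally show ?thesis .
qed

lemma superlevel_tendsto:
  assumes fin: "finite_measure \<nu>" and sets: "sets \<nu> = sets \<mu>" and c: "0 \<le> c"
    and dirac: "\<And>y. 0 \<le> y \<Longrightarrow>
      ((\<lambda>l. ennreal l * emeasure \<mu> (superlevel \<mu> (dirac_on {0..} y) l)) \<longlongrightarrow> ennreal c) (at_right 0)"
  shows "((\<lambda>l. ennreal l * emeasure \<mu> (superlevel \<mu> \<nu> l)) \<longlongrightarrow> ennreal c * emeasure \<nu> {0..}) (at_right 0)"
proof -
  interpret finite_measure \<nu> by fact
  have meas: "{0..} \<in> sets \<nu>" "{0..A} \<in> sets \<nu>" for A :: real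
    using sets by (auto simp: sets_iff)
  define N where "N = measure \<nu> {0..}"
  have N_eq: "emeasure \<nu> {0..} = ennreal N" by (simp add: N_def emeasure_eq_measure)
  show ?thesis
  proof (cases "N = 0")
    \<comment> \<open>The level (1 - t) / N * l is meaningless here, but the weak type bound forces
      every product to be 0.\<close>
    case True
    have "ennreal l * emeasure \<mu> (superlevel \<mu> \<nu> l) = 0" for l
      using weak_type_bound[OF sets, of l] True N_eq by simp
    then show ?thesis unfolding N_eq True by (simp only: tendsto_const ennreal_0 mult_zero_right)
  next
    case False
    then have N: "0 < N" unfolding N_def by (simp add: less_le)
    have DS: "superlevel \<mu> (dirac_on {0..} y) l \<in> sets \<mu>" if "0 \<le> y" for y l
      using that by (intro superlevel_sets finite_measure_dirac_on) (simp_all add: dirac_on_def sets_eq)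
    have lim_eq: "ennreal c * emeasure \<nu> {0..} = ennreal (c * N)"
      using c N by (simp add: N_eq ennreal_mult)
    show ?thesis unfolding lim_eq
    proof (rule order_tendstoI)
      fix a assume "ennreal (c * N) < a"
      \<comment> \<open>Upper half. As \<open>a\<close> may be infinite, a finite bound is
        interposed so that \<open>t\<close> and \<open>A\<close> can be chosen by real
        estimates.\<close>
      then obtain b' where b': "ennreal (c * N) < b'" "b' < a" using dense by blast
      then have "b' < top" by (metis less_trans top.not_eq_extremum)
      then obtain b where b: "b' = ennreal b" "0 \<le> b" by (metis ennreal_enn2real enn2real_nonneg)
      have cNb: "c * N < b" using b b' c N by (simp add: ennreal_less_iff)
      have "((\<lambda>t. c * N / (1 - t)) \<longlongrightarrow> c * N / (1 - 0)) (at_right (0::real))"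
        by (intro tendsto_intros) auto
      then have "\<forall>\<^sub>F t in at_right (0::real). c * N / (1 - t) < b"
        using cNb by (intro order_tendstoD(2)) auto
      moreover have "\<forall>\<^sub>F t in at_right (0::real). 0 < t \<and> t < 1"
        by (rule eventually_at_rightI[of 0 1]) auto
      ultimately have "\<forall>\<^sub>F t in at_right (0::real). c * N / (1 - t) < b \<and> 0 < t \<and> t < 1"
        by (rule eventually_conj)
      then obtain t where t: "c * N / (1 - t) < b" "0 < t" "t < 1"
        using eventually_happens'[OF trivial_limit_at_right_real] by blast
      \<comment> \<open>With \<open>t\<close> fixed, finiteness of \<nu> makes the tail beyond
        \<open>n\<close> small even after division by \<open>t\<close>.\<close>
      have "(\<lambda>n. measure \<nu> {real n<..}) \<longlonglongrightarrow> measure \<nu> (\<Inter>n. {real n<..})"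
      proof (rule finite_Lim_measure_decseq)
        show "range (\<lambda>n. {real n<..}) \<subseteq> sets \<nu>"
          unfolding sets by (intro image_subsetI) (simp add: sets_iff subset_iff)
        show "decseq (\<lambda>n. {real n<..})" by (rule decseq_SucI) (simp add: subset_iff)
      qed
      moreover have "(\<Inter>n. {real n<..}) = {}"
      proof -
        have "x \<notin> (\<Inter>n. {real n<..})" for x
        proof -
          obtain n where "x < real n" using reals_Archimedean2 by blast
          then have "x \<notin> {real n<..}" by simp
          then show ?thesis by blast
        qed
        then show ?thesis by blast
      qed
      ultimately have "(\<lambda>n. c * N / (1 - t) + 2 * measure \<nu> {real n<..} / t) \<longlonglongrightarrow> c * N / (1 - t) + 2 * 0 / t"
        by (intro tendsto_intros) (use t in auto)
      then have "\<forall>\<^sub>F n in sequentially. c * N / (1 - t) + 2 * measure \<nu> {real n<..} / t < b"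
        using t by (intro order_tendstoD(2)) auto
      then obtain n where n: "c * N / (1 - t) + 2 * measure \<nu> {real n<..} / t < b"
        by (auto simp: eventually_sequentially)
      define A where "A = real n"
      have A: "0 \<le> A" by (simp add: A_def)
      define \<rho> where "\<rho> = density \<nu> (indicator {A<..})"
      have A_meas: "{A<..} \<in> sets \<nu>" using sets A by (auto simp: sets_iff)
      have \<rho>_sets: "sets \<rho> = sets \<mu>" by (simp add: \<rho>_def sets)
      have \<rho>_fin: "finite_measure \<rho>"
        unfolding \<rho>_def using A_meas by (rule finite_measure_restricted)
      have "{A<..} \<inter> {0..} = {A<..}" using A by auto
      then have \<rho>_mass: "emeasure \<rho> {0..} = ennreal (measure \<nu> {A<..})"
        unfolding \<rho>_def using A_meas meas by (simp add: emeasure_restricted emeasure_eq_measure)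
      define k where "k = (1 - t) / N"
      have k: "0 < k" using t N by (simp add: k_def)
      \<comment> \<open>The three terms bound the three sets of the splitting; the last is already
        the weak type bound at level \<open>t * l\<close>, a constant in \<open>l\<close>.\<close>
      define h where "h l = ennreal l * emeasure \<mu> {0..A}
         + ennreal l * emeasure \<mu> (superlevel \<mu> (dirac_on {0..} A) (k * l))
         + ennreal (2 * measure \<nu> {A<..} / t)" for l
      have le: "ennreal l * emeasure \<mu> (superlevel \<mu> \<nu> l) \<le> h l" if l: "0 < l" for l
      proof -
        have sub: "superlevel \<mu> \<nu> l \<subseteq> {0..A} \<union> superlevel \<mu> (dirac_on {0..} A) (k * l) \<union> superlevel \<mu> \<rho> (t * l)"
          unfolding k_def \<rho>_def N_def
          using N by (intro superlevel_split fin sets t A l) (simp add: N_def)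
        have ms: "{0..A} \<in> sets \<mu>" "superlevel \<mu> (dirac_on {0..} A) (k * l) \<in> sets \<mu>" "superlevel \<mu> \<rho> (t * l) \<in> sets \<mu>"
          using DS[OF A] superlevel_sets[OF \<rho>_fin \<rho>_sets] meas sets by auto
        have "emeasure \<mu> (superlevel \<mu> \<nu> l)
          \<le> emeasure \<mu> ({0..A} \<union> superlevel \<mu> (dirac_on {0..} A) (k * l) \<union> superlevel \<mu> \<rho> (t * l))"
          using sub ms by (intro emeasure_mono) auto
        also have "\<dots> \<le> emeasure \<mu> ({0..A} \<union> superlevel \<mu> (dirac_on {0..} A) (k * l)) + emeasure \<mu> (superlevel \<mu> \<rho> (t * l))"
          using ms by (intro emeasure_subadditive) auto
        also have "\<dots> \<le> emeasure \<mu> {0..A} + emeasure \<mu> (superlevel \<mu> (dirac_on {0..} A) (k * l)) + emeasure \<mu> (superlevel \<mu> \<rho> (t * l))"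
          using ms by (intro add_right_mono emeasure_subadditive) auto
        finally have "ennreal l * emeasure \<mu> (superlevel \<mu> \<nu> l) \<le> ennreal l * emeasure \<mu> {0..A}
           + ennreal l * emeasure \<mu> (superlevel \<mu> (dirac_on {0..} A) (k * l))
           + ennreal l * emeasure \<mu> (superlevel \<mu> \<rho> (t * l))"
          by (metis (no_types, lifting) distrib_left mult_left_mono zero_le)
        also have "ennreal l * emeasure \<mu> (superlevel \<mu> \<rho> (t * l))
            = ennreal (1 / t) * (ennreal (t * l) * emeasure \<mu> (superlevel \<mu> \<rho> (t * l)))"
          using t by (simp add: mult.assoc[symmetric] ennreal_mult'[symmetric])
        also have "\<dots> \<le> ennreal (1 / t) * (2 * emeasure \<rho> {0..})"
          by (intro mult_left_mono weak_type_bound \<rho>_sets) simp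
        also have "\<dots> = ennreal (2 * measure \<nu> {A<..} / t)"
          using t unfolding \<rho>_mass ennreal_numeral[symmetric]
          by (simp add: ennreal_mult'[symmetric] del: ennreal_numeral)
        finally show ?thesis by (simp add: h_def add_left_mono)
      qed
      have "(h \<longlongrightarrow> 0 + ennreal (c / k) + ennreal (2 * measure \<nu> {A<..} / t)) (at_right 0)"
        unfolding h_def
        by (intro tendsto_add tendsto_const times_emeasure_Icc_tendsto_0 superlevel_rescale k dirac A)
      moreover have "0 + ennreal (c / k) + ennreal (2 * measure \<nu> {A<..} / t) < a"
      proof -
        have "0 + ennreal (c / k) + ennreal (2 * measure \<nu> {A<..} / t) = ennreal (c * N / (1 - t) + 2 * measure \<nu> {A<..} / t)"
          using c k t N by (simp add: ennreal_plus[symmetric] k_def del: ennreal_plus)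
        also have "\<dots> < ennreal b"
          using n c t N by (intro ennreal_lessI) (auto simp: A_def intro: le_less_trans[rotated])
        finally show ?thesis using b b' by (auto intro: less_trans)
      qed
      ultimately have "\<forall>\<^sub>F l in at_right 0. h l < a" by (rule order_tendstoD(2))
      then show "\<forall>\<^sub>F l in at_right 0. ennreal l * emeasure \<mu> (superlevel \<mu> \<nu> l) < a"
        using eventually_at_right_less[of "0::real"]
        by eventually_elim (meson le le_less_trans)
    next
      \<comment> \<open>Lower half: the masses of [0,n] increase to N, so some bounded part already
        pushes the limit above \<open>a\<close>.\<close>
      fix a assume a: "a < ennreal (c * N)"
      have "(\<lambda>n. measure \<nu> {0..real n}) \<longlonglongrightarrow> measure \<nu> (\<Union>n. {0..real n})"
        using meas by (intro finite_Lim_measure_incseq) (auto simp: incseq_def)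
      moreover have "(\<Union>n. {0..real n}) = {0..}" by (auto intro: real_arch_simple)
      ultimately have "(\<lambda>n. ennreal (c * measure \<nu> {0..real n})) \<longlonglongrightarrow> ennreal (c * N)"
        unfolding N_def by (intro tendsto_intros) simp
      from order_tendstoD(1)[OF this a] obtain n where n: "a < ennreal (c * measure \<nu> {0..real n})"
        by (auto simp: eventually_sequentially)
      define A where "A = real n"
      define m where "m = measure \<nu> {0..A}"
      have A: "0 \<le> A" by (simp add: A_def)
      have am: "a < ennreal (c * m)" using n by (simp add: A_def m_def)
      have "m \<noteq> 0" using am by auto
      then have m: "0 < m" unfolding m_def by (simp add: less_le)
      \<comment> \<open>Truncated subtraction is harmless in a lower bound; the subtrahend is
        finite, which excludes \<open>top - top = top\<close>.\<close>
      define h where "h l = ennreal l * emeasure \<mu> (superlevel \<mu> (dirac_on {0..} 0) (1 / m * l))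
         - ennreal l * emeasure \<mu> {0..A}" for l
      have le: "h l \<le> ennreal l * emeasure \<mu> (superlevel \<mu> \<nu> l)" if l: "0 < l" for l
      proof -
        have sub: "superlevel \<mu> (dirac_on {0..} 0) (1 / m * l) \<subseteq> {0..A} \<union> superlevel \<mu> \<nu> l"
          unfolding m_def using m by (intro superlevel_dirac_0_subset fin sets A l) (simp add: m_def)
        have ms: "{0..A} \<in> sets \<mu>" "superlevel \<mu> \<nu> l \<in> sets \<mu>"
          using superlevel_sets[OF fin sets] meas sets by auto
        have "emeasure \<mu> (superlevel \<mu> (dirac_on {0..} 0) (1 / m * l)) \<le> emeasure \<mu> ({0..A} \<union> superlevel \<mu> \<nu> l)"
          using sub ms by (intro emeasure_mono) auto
        also have "\<dots> \<le> emeasure \<mu> {0..A} + emeasure \<mu> (superlevel \<mu> \<nu> l)"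
          using ms by (intro emeasure_subadditive) auto
        finally have "ennreal l * emeasure \<mu> (superlevel \<mu> (dirac_on {0..} 0) (1 / m * l))
           \<le> ennreal l * emeasure \<mu> {0..A} + ennreal l * emeasure \<mu> (superlevel \<mu> \<nu> l)"
          by (metis (no_types, lifting) distrib_left mult_left_mono zero_le)
        then show ?thesis
          using emeasure_Icc_less_top[of A]
          by (auto simp: h_def ennreal_minus_le_iff ennreal_mult_eq_top_iff)
      qed
      have "(h \<longlongrightarrow> ennreal (c / (1 / m)) - 0) (at_right 0)"
        unfolding h_def using m
        by (intro tendsto_diff_ennreal times_emeasure_Icc_tendsto_0 superlevel_rescale dirac) auto
      then have "\<forall>\<^sub>F l in at_right 0. a < h l"
        using am by (intro order_tendstoD(1)) auto
      then show "\<forall>\<^sub>F l in at_right 0. a < ennreal l * emeasure \<mu> (superlevel \<mu> \<nu> l)"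
        using eventually_at_right_less[of "0::real"]
        by eventually_elim (meson le less_le_trans)
    qed
  qed
qed

end

section \<open>The equivalence\<close>

theorem theorem1p1:
  fixes \<mu> :: "real measure" and c0 :: real
  assumes "is_borel_measure_on {0..} \<mu>"
    and "finite_on_bounded \<mu>"
    and "msupport \<mu> \<noteq> {}"
    and "c0 \<ge> 0"
  shows "(\<forall>\<nu>. is_radon_measure_on {0..} \<nu> \<and> finite_measure \<nu> \<longrightarrow>
            ((\<lambda>l. ennreal l * emeasure \<mu> {x\<in>{0..}. centered_maximal \<mu> \<nu> x > ennreal l})
               \<longlongrightarrow> ennreal c0 * emeasure \<nu> {0..}) (at_right 0))
     \<longleftrightarrow>
         (\<forall>y\<in>{0..}.
            ((\<lambda>l. ennreal l * emeasure \<mu> {x\<in>{0..}. centered_maximal \<mu> (dirac_on {0..} y) x > ennreal l})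
               \<longlongrightarrow> ennreal c0) (at_right 0))"
    (is "?i \<longleftrightarrow> ?ii")
proof
  assume i: ?i
  show ?ii
  proof
    fix y :: real assume y: "y \<in> {0..}"
    have "is_radon_measure_on {0..} (dirac_on {0..} y)"
      using y by (intro is_radon_measure_on_dirac) auto
    moreover have "finite_measure (dirac_on {0..} y)"
      using y by (rule finite_measure_dirac_on)
    moreover have "emeasure (dirac_on {0..} y) {0..} = 1"
      using y by (simp add: dirac_on_def borel_on_def sets_restrict_space_iff)
    ultimately show "((\<lambda>l. ennreal l * emeasure \<mu> {x\<in>{0..}. centered_maximal \<mu> (dirac_on {0..} y) x > ennreal l})
               \<longlongrightarrow> ennreal c0) (at_right 0)"
      using i[rule_format, of "dirac_on {0..} y"] by simp
  qed
next
  assume ii: ?ii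
  interpret half_line_measure \<mu>
    using assms(1,2) by unfold_locales (auto simp: is_borel_measure_on_def)
  \<comment> \<open>The two descriptions of the level set agree for positive \<open>l\<close>, and
    \<open>at_right 0\<close> sees no others.\<close>
  have cong: "((\<lambda>l. ennreal l * emeasure \<mu> {x\<in>{0..}. centered_maximal \<mu> \<nu> x > ennreal l}) \<longlongrightarrow> c) (at_right 0)
      \<longleftrightarrow> ((\<lambda>l. ennreal l * emeasure \<mu> (superlevel \<mu> \<nu> l)) \<longlongrightarrow> c) (at_right 0)"
    if "sets \<nu> = sets \<mu>" for \<nu> c
    using eventually_at_right_less[of "0::real"]
    by (intro tendsto_cong) (auto elim!: eventually_mono simp only: centered_maximal_superlevel[OF assms(3) that])
  have dirac: "((\<lambda>l. ennreal l * emeasure \<mu> (superlevel \<mu> (dirac_on {0..} y) l)) \<longlongrightarrow> ennreal c0) (at_right 0)"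
    if "0 \<le> y" for y
  proof -
    have "sets (dirac_on {0..} y) = sets \<mu>" by (simp add: dirac_on_def sets_eq)
    then show ?thesis using ii that cong by auto
  qed
  show ?i
  proof (intro allI impI)
    fix \<nu> :: "real measure" assume \<nu>: "is_radon_measure_on {0..} \<nu> \<and> finite_measure \<nu>"
    then have "sets \<nu> = sets \<mu>"
      by (simp add: is_radon_measure_on_def is_borel_measure_on_def sets_eq)
    then show "((\<lambda>l. ennreal l * emeasure \<mu> {x\<in>{0..}. centered_maximal \<mu> \<nu> x > ennreal l})
               \<longlongrightarrow> ennreal c0 * emeasure \<nu> {0..}) (at_right 0)"
      using \<nu> superlevel_tendsto[OF _ _ assms(4) dirac] cong by blast
  qed
qed

end
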